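(* If $f\in\mathcal{U}$ then $L(r,f)\le L(r,k)$ for every $0<r<1$, where $k(z)=z/(1-z)^2$ is the Koebe function.
   Context: $\mathbb{D}=\{z\in\mathbb{C}:|z|<1\}$. $\mathcal{A}$ is the set of analytic functions on $\mathbb{D}$ of the form $f(z)=z+\sum_{n=2}^\infty a_nz^n$. $\mathcal{U}$ is the class of $f\in\mathcal{A}$ satisfying $\left|f'(z)\left(\frac{z}{f(z)}\right)^2-1\right|<1$ for all $z\in\mathbb{D}$ (where $z/f(z)$ has the value $1$ at $z=0$; such $f$ is nonvanishing in $\mathbb{D}\setminus\{0\}$). For $f$ analytic in $\mathbb{D}$ and $0<r<1$, $L(r,f)=\int_0^{2\pi}r|f'(re^{i\theta})|\,d\theta$ is the arclength of the image of the circle $|z|=r$ under $f$. *)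

theory Defs
  imports "HOL-Complex_Analysis.Complex_Analysis"
begin

abbreviation unit_disc :: "complex set" where
  "unit_disc \<equiv> ball 0 1"

definition class_A :: "(complex \<Rightarrow> complex) set" where
  "class_A = {f. f analytic_on unit_disc \<and>
     (\<exists>a :: nat \<Rightarrow> complex. \<forall>z \<in> unit_disc. (\<lambda>n. a (n + 2) * z ^ (n + 2)) sums (f z - z))}"

text \<open>The function \<open>z / f z\<close>, with its removable singularity at the origin filled in
  (for normalised \<open>f\<close> the value there is 1).\<close>

definition z_over :: "(complex \<Rightarrow> complex) \<Rightarrow> complex \<Rightarrow> complex" where
  "z_over f z = (if z = 0 then 1 else z / f z)"

text \<open>The inequality presupposes that \<open>f\<close> has no zero in the punctured disc; we state this
  explicitly so that the definition does not rely on the convention \<open>x / 0 = 0\<close>.\<close>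

definition class_U :: "(complex \<Rightarrow> complex) set" where
  "class_U = {f \<in> class_A. (\<forall>z \<in> unit_disc - {0}. f z \<noteq> 0) \<and>
     (\<forall>z \<in> unit_disc. cmod (deriv f z * (z_over f z)\<^sup>2 - 1) < 1)}"

definition arclength :: "real \<Rightarrow> (complex \<Rightarrow> complex) \<Rightarrow> real" where
  "arclength r f =
     integral {0..2 * pi} (\<lambda>\<theta>. r * cmod (deriv f (of_real r * exp (\<i> * of_real \<theta>))))"

definition koebe :: "complex \<Rightarrow> complex" where
  "koebe z = z / (1 - z)\<^sup>2"

end

theory Submission
  imports Defs
begin

text \<open>
  Write \<open>k z = z / (1 - z)\<^sup>2\<close>. The derivative splits as
  \<open>k' u = (1 / (1 - u)) \<cdot> ((1 + u) / (1 - u)\<^sup>2)\<close>, and on a circle \<open>|u| = R < 1\<close> the moduli of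
  both factors are increasing functions of \<open>Re u\<close>. The proof brings \<open>f'\<close> into a matching form.

  For \<open>f\<close> in the class, \<open>z / f z\<close> is holomorphic and zero-free, hence a square \<open>(s z)\<^sup>2\<close> with
  \<open>s 0 = 1\<close>. In terms of \<open>\<phi> = 1 - s\<close> the defining inequality says that
  \<open>(1 - \<phi>) (1 - \<phi> + 2 z \<phi>') - 1\<close> has modulus less than 1. At a point where \<open>|\<phi>|\<close> first
  reaches 1, Jack's lemma gives \<open>z \<phi>' = m \<phi>\<close> with \<open>m \<ge> 1\<close>, and then this modulus is
  \<open>|2 m - 2 - (2 m - 1) \<phi>| \<ge> 1\<close>. So \<open>|\<phi>| < 1\<close> throughout the disc
  (\<open>class_U_imp_sqrt\<close>); that is, \<open>f z / z\<close> is subordinate to \<open>1 / (1 - z)\<^sup>2\<close>.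

  It follows that \<open>p = 1 / s\<close> has real part greater than \<open>1/2\<close>, while \<open>f z = z (p z)\<^sup>2\<close> and
  \<open>f' = p (p + 2 z p')\<close>. By a Herglotz representation on the circle \<open>|\<zeta>| = \<rho>\<close>, both \<open>p\<close>
  and \<open>p + 2 z p'\<close> are averages, against one and the same probability density
  \<open>q = 2 Re p - 1\<close>, of \<open>1 / (1 - u)\<close> and \<open>(1 + u) / (1 - u)\<^sup>2\<close> with \<open>u = z / \<zeta>\<close>. As
  \<open>\<zeta>\<close> runs over the circle these two kernels have similarly ordered moduli, so Chebyshev's
  integral inequality bounds the product of the two averages by the average of the product:
  \<open>|f' z|\<close> is at most the \<open>q\<close>-average of \<open>|k' (z / \<zeta>)|\<close> (\<open>deriv_le_koebe_average\<close>).

  Integrating over \<open>|z| = r\<close> and interchanging the integrals, each inner integral is a rotated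
  copy of the Koebe integral at radius \<open>r / \<rho>\<close>, and \<open>q\<close> integrates out to 1. Finally \<open>\<rho>\<close>
  tends to 1.
\<close>

section \<open>Jack's lemma\<close>

lemma norm_le_on_closed_disc:
  fixes \<phi> :: "complex \<Rightarrow> complex"
  assumes cont: "continuous_on (cball 0 \<rho>) \<phi>" and \<rho>: "\<rho> > 0"
    and le: "\<And>z. cmod z < \<rho> \<Longrightarrow> cmod (\<phi> z) \<le> B" and z: "cmod z \<le> \<rho>"
  shows "cmod (\<phi> z) \<le> B"
proof (rule continuous_le_on_closure[where S = "ball 0 \<rho>" and f = "\<lambda>z. cmod (\<phi> z)"])
  show "continuous_on (closure (ball 0 \<rho>)) (\<lambda>z. cmod (\<phi> z))"
    using cont \<rho> by (simp add: closure_ball continuous_on_norm)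
qed (use \<rho> z le in \<open>auto simp: closure_ball\<close>)

text \<open>
  Schwarz's lemma, rescaled to the disc of radius \<open>|z0|\<close>, says that \<open>|\<phi> / \<phi> z0|\<close> is at most
  \<open>|z| / |z0|\<close>. Comparing derivatives at \<open>z0\<close> along the radius shows that the logarithmic
  derivative has real part at least 1. Along the circle through \<open>z0\<close> the modulus is maximal at
  \<open>z0\<close>, which makes the imaginary part vanish.
\<close>

lemma Jack_lemma:
  fixes \<phi> :: "complex \<Rightarrow> complex"
  assumes hol: "\<phi> holomorphic_on ball 0 R" and "\<phi> 0 = 0"
    and z0: "z0 \<in> ball 0 R" "z0 \<noteq> 0" and nz: "\<phi> z0 \<noteq> 0"
    and less: "\<And>z. cmod z < cmod z0 \<Longrightarrow> cmod (\<phi> z) < cmod (\<phi> z0)"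
  shows "\<exists>m::real. m \<ge> 1 \<and> z0 * deriv \<phi> z0 = of_real m * \<phi> z0"
proof -
  define d where "d = z0 * deriv \<phi> z0 / \<phi> z0"
  have der: "(\<phi> has_field_derivative deriv \<phi> z0) (at z0)"
    using hol z0(1) by (intro holomorphic_derivI[of _ "ball 0 R"]) auto
  have schwarz: "cmod (\<phi> (z0 * w) / \<phi> z0) \<le> cmod w" if "cmod w < 1" for w
  proof (rule Schwarz_Lemma(1)[where f = "\<lambda>w. \<phi> (z0 * w) / \<phi> z0"])
    have "cmod (z0 * w) < R" if "cmod w < 1" for w
    proof -
      have "cmod z0 * cmod w \<le> cmod z0 * 1"
        using that by (intro mult_left_mono) auto
      then show ?thesis using z0(1) by (simp add: norm_mult)
    qed
    then have "(\<lambda>w. \<phi> (z0 * w)) holomorphic_on ball 0 1"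
      by (intro holomorphic_on_compose_gen[OF _ hol, unfolded o_def] holomorphic_intros) auto
    then show "(\<lambda>w. \<phi> (z0 * w) / \<phi> z0) holomorphic_on ball 0 1"
      using nz by (intro holomorphic_intros) auto
    show "cmod (\<phi> (z0 * w) / \<phi> z0) < 1" if "cmod w < 1" for w
    proof -
      have "cmod (z0 * w) < cmod z0" using that z0(2) by (simp add: norm_mult)
      from less[OF this] nz show ?thesis by (simp add: norm_divide)
    qed
  qed (use assms that in auto)
  have "Re d \<ge> 1"
  proof (rule ccontr)
    assume "\<not> Re d \<ge> 1"
    (* ?k is at most 0 on the radius and vanishes at its endpoint, but would decrease there. *)
    let ?k = "\<lambda>t::real. Re (\<phi> (z0 * of_real t) / \<phi> z0) - t"
    have "((\<lambda>t. z0 * of_real t) has_vector_derivative z0) (at (1::real))"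
      by (auto intro!: derivative_eq_intros)
    from field_vector_diff_chain_at[OF this, of \<phi> "deriv \<phi> z0"] der
    have "((\<lambda>t. \<phi> (z0 * of_real t)) has_vector_derivative (z0 * deriv \<phi> z0)) (at (1::real))"
      by (simp add: o_def)
    then have "((\<lambda>t. \<phi> (z0 * of_real t) / \<phi> z0) has_vector_derivative d) (at (1::real))"
      unfolding d_def by (rule has_vector_derivative_divide)
    then have "((\<lambda>t. Re (\<phi> (z0 * of_real t) / \<phi> z0)) has_vector_derivative Re d) (at (1::real))"
      by (rule bounded_linear.has_vector_derivative[OF bounded_linear_Re])
    then have "((\<lambda>t. Re (\<phi> (z0 * of_real t) / \<phi> z0)) has_real_derivative Re d) (at (1::real))"
      by (simp add: has_real_derivative_iff_has_vector_derivative)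
    from DERIV_diff[OF this DERIV_ident]
    have "(?k has_real_derivative Re d - 1) (at 1)" by simp
    from DERIV_neg_dec_left[OF this] \<open>\<not> Re d \<ge> 1\<close>
    obtain e where e: "e > 0" "\<And>h. h > 0 \<Longrightarrow> h < e \<Longrightarrow> ?k 1 < ?k (1 - h)" by auto
    define h where "h = min (1/2) (e/2)"
    have h: "h > 0" "h < e" "h < 1" using e(1) by (auto simp: h_def)
    have "?k 1 < ?k (1 - h)" using e(2) h by blast
    moreover have "?k 1 = 0" using nz by simp
    moreover have "Re (\<phi> (z0 * of_real (1 - h)) / \<phi> z0) \<le> 1 - h"
      using schwarz[of "of_real (1 - h)"] h
      by (intro order.trans[OF complex_Re_le_cmod]) (simp del: of_real_diff)
    ultimately show False by simp
  qed
  moreover have "Im d = 0"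
  proof -
    let ?k = "\<lambda>t::real. Re (\<phi> (z0 * exp (\<i> * of_real t)) / \<phi> z0)"
    have "((\<lambda>t. z0 * exp (\<i> * of_real t)) has_vector_derivative (\<i> * z0)) (at (0::real))"
      by (auto intro!: derivative_eq_intros has_vector_derivative_real_field)
    from field_vector_diff_chain_at[OF this, of \<phi> "deriv \<phi> z0"] der
    have "((\<lambda>t. \<phi> (z0 * exp (\<i> * of_real t))) has_vector_derivative (\<i> * z0 * deriv \<phi> z0)) (at (0::real))"
      by (simp add: o_def)
    from has_vector_derivative_divide[OF this, of "\<phi> z0"]
    have "((\<lambda>t. \<phi> (z0 * exp (\<i> * of_real t)) / \<phi> z0) has_vector_derivative \<i> * d) (at (0::real))"
      by (simp add: d_def mult.assoc)
    from bounded_linear.has_vector_derivative[OF bounded_linear_Re this]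
    have der: "(?k has_real_derivative - Im d) (at 0)"
      by (simp add: has_real_derivative_iff_has_vector_derivative)
    have cont: "continuous_on (cball 0 (cmod z0)) \<phi>"
      using holomorphic_on_imp_continuous_on[OF hol] by (rule continuous_on_subset) (use z0(1) in auto)
    have "?k t \<le> ?k 0" for t
    proof -
      have "cmod (\<phi> (z0 * exp (\<i> * of_real t))) \<le> cmod (\<phi> z0)"
        using z0(2) by (intro norm_le_on_closed_disc[OF cont _ less_imp_le[OF less]]) (auto simp: norm_mult)
      then have "cmod (\<phi> (z0 * exp (\<i> * of_real t)) / \<phi> z0) \<le> 1"
        using nz by (simp add: norm_divide)
      then show ?thesis using complex_Re_le_cmod order.trans nz by fastforce
    qed
    then have "- Im d = 0" by (intro DERIV_local_max[OF der zero_less_one]) auto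
    then show ?thesis by simp
  qed
  ultimately have "of_real (Re d) = d" by (simp add: complex_eq_iff)
  then have "z0 * deriv \<phi> z0 = of_real (Re d) * \<phi> z0"
    using nz by (simp add: d_def)
  with \<open>Re d \<ge> 1\<close> show ?thesis by blast
qed

section \<open>Subordination for the class U\<close>

lemma class_A_normalised:
  assumes "f \<in> class_A"
  shows "f 0 = 0" "deriv f 0 = 1"
proof -
  obtain a where a: "\<And>z. z \<in> unit_disc \<Longrightarrow> (\<lambda>n. a (n + 2) * z ^ (n + 2)) sums (f z - z)"
    using assms unfolding class_A_def by blast
  have "(\<lambda>n. 0) sums (f 0 - 0)" using a[of 0] by simp
  then show f0: "f 0 = 0" using sums_unique2[OF _ sums_zero] by force
  (* The full Taylor coefficients of f, with the normalisation built in. *)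
  define c where "c n = (if n = 0 then 0 else if n = 1 then 1 else a n)" for n :: nat
  have c: "(\<lambda>n. c n * z ^ n) sums f z" if "z \<in> unit_disc" for z
  proof -
    have "(\<lambda>n. c (n + 2) * z ^ (n + 2)) sums (f z - z)"
      using a[OF that] by (simp add: c_def)
    then have "(\<lambda>n. c n * z ^ n) sums (f z - z + (\<Sum>n<2. c n * z ^ n))"
      by (subst (asm) sums_iff_shift)
    then show ?thesis by (simp add: c_def numeral_2_eq_2)
  qed
  have "((\<lambda>z. \<Sum>n. c n * z ^ n) has_field_derivative (\<Sum>n. diffs c n * 0 ^ n)) (at 0)"
    by (rule termdiffs_strong[where K = "1/2"]) (use c[of "1/2"] in \<open>auto simp: sums_iff\<close>)
  then have "((\<lambda>z. \<Sum>n. c n * z ^ n) has_field_derivative 1) (at 0)"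
    by (simp add: diffs_def c_def)
  then have "(f has_field_derivative 1) (at 0)"
    by (rule has_field_derivative_transform_within_open[of _ _ _ unit_disc])
       (use c in \<open>auto simp: sums_iff\<close>)
  then show "deriv f 0 = 1" by (rule DERIV_imp_deriv)
qed

text \<open>
  The subordination of \<open>f z / z\<close> to \<open>1 / (1 - z)\<^sup>2\<close>, expressed by the square root \<open>s\<close> of
  \<open>z / f z\<close>: it is Jack's lemma, applied to \<open>1 - s\<close> at a point of smallest modulus where
  \<open>|1 - s| \<ge> 1\<close>.
\<close>

lemma class_U_imp_sqrt:
  assumes "f \<in> class_U"
  obtains s where "s holomorphic_on unit_disc" "s 0 = 1" "\<And>z. z \<in> unit_disc \<Longrightarrow> s z \<noteq> 0"
    "\<And>z. z \<in> unit_disc \<Longrightarrow> f z = z / (s z)\<^sup>2"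
    "\<And>z. z \<in> unit_disc \<Longrightarrow> cmod (1 - s z) < 1"
proof -
  have fA: "f \<in> class_A" and fnz: "\<And>z. z \<in> unit_disc \<Longrightarrow> z \<noteq> 0 \<Longrightarrow> f z \<noteq> 0"
    and U: "\<And>z. z \<in> unit_disc \<Longrightarrow> cmod (deriv f z * (z_over f z)\<^sup>2 - 1) < 1"
    using assms by (auto simp: class_U_def)
  have holf: "f holomorphic_on unit_disc"
    using fA by (auto simp: class_A_def analytic_imp_holomorphic)
  define F where "F z = (if z = 0 then 1 else f z / z)" for z
  have "F holomorphic_on unit_disc"
    by (rule pole_theorem_open_0[OF holf, where a = 0])
       (auto simp: F_def class_A_normalised[OF fA])
  moreover have Fnz: "F z \<noteq> 0" if "z \<in> unit_disc" for z using fnz that by (auto simp: F_def)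
  ultimately have "(\<lambda>z. 1 / F z) holomorphic_on unit_disc"
    by (intro holomorphic_intros)
  then obtain s0 where s0: "s0 holomorphic_on unit_disc" "\<And>z. z \<in> unit_disc \<Longrightarrow> 1 / F z = (s0 z)\<^sup>2"
    by (rule contractible_imp_holomorphic_sqrt)
       (use Fnz in \<open>auto simp: convex_imp_contractible\<close>)
  have s00: "s0 0 ^ 2 = 1" using s0(2)[of 0] by (simp add: F_def)
  (* The root is only determined up to sign; dividing by s0 0 picks the branch with s 0 = 1. *)
  define s where "s z = s0 z / s0 0" for z
  have hols: "s holomorphic_on unit_disc"
    unfolding s_def using s0(1) s00 by (intro holomorphic_intros) auto
  have s1: "s 0 = 1" using s00 by (auto simp: s_def)
  have sF: "(s z)\<^sup>2 = 1 / F z" if "z \<in> unit_disc" for z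
    using s0(2)[OF that] s00 by (simp add: s_def power_divide)
  have snz: "s z \<noteq> 0" if "z \<in> unit_disc" for z using sF[OF that] Fnz[OF that] by auto
  have fs: "f z = z / (s z)\<^sup>2" if "z \<in> unit_disc" for z
    using sF[OF that] class_A_normalised[OF fA] by (auto simp: F_def)
  (* The inequality defining the class, rewritten in terms of s. *)
  have U': "cmod ((s z)\<^sup>2 - 2 * (z * deriv s z) * s z - 1) < 1" if z: "z \<in> unit_disc" for z
  proof -
    have "(s has_field_derivative deriv s z) (at z)"
      using hols z by (intro holomorphic_derivI[of _ "ball 0 1"]) auto
    then have "((\<lambda>z. z / (s z)\<^sup>2) has_field_derivative
        ((s z)\<^sup>2 - z * (2 * s z * deriv s z)) / ((s z)\<^sup>2 * (s z)\<^sup>2)) (at z)"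
      using snz[OF z] by (auto intro!: derivative_eq_intros simp: power2_eq_square)
    then have "(f has_field_derivative
        ((s z)\<^sup>2 - z * (2 * s z * deriv s z)) / ((s z)\<^sup>2 * (s z)\<^sup>2)) (at z)"
      by (rule has_field_derivative_transform_within_open[of _ _ _ unit_disc]) (use z fs in auto)
    then have "deriv f z = ((s z)\<^sup>2 - z * (2 * s z * deriv s z)) / ((s z)\<^sup>2 * (s z)\<^sup>2)"
      by (rule DERIV_imp_deriv)
    moreover have "z_over f z = (s z)\<^sup>2"
      using fs[OF z] snz[OF z] s1 by (auto simp: z_over_def)
    ultimately have "deriv f z * (z_over f z)\<^sup>2 - 1 = (s z)\<^sup>2 - 2 * (z * deriv s z) * s z - 1"
      using snz[OF z] by (simp add: power2_eq_square)
    with U[OF z] show ?thesis by simp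
  qed
  have "cmod (1 - s z1) < 1" if z1: "z1 \<in> unit_disc" for z1
  proof (rule ccontr)
    assume ge: "\<not> cmod (1 - s z1) < 1"
    define \<phi> where "\<phi> z = 1 - s z" for z
    have hol\<phi>: "\<phi> holomorphic_on unit_disc"
      unfolding \<phi>_def by (intro holomorphic_intros hols)
    define K where "K = {z \<in> cball 0 (cmod z1). 1 \<le> cmod (\<phi> z)}"
    have cont: "continuous_on (cball 0 (cmod z1)) \<phi>"
      using holomorphic_on_imp_continuous_on[OF hol\<phi>] by (rule continuous_on_subset) (use z1 in auto)
    have "closed (cball 0 (cmod z1) \<inter> (\<lambda>z. cmod (\<phi> z)) -` {1..})"
      by (intro continuous_closed_preimage continuous_on_norm cont) auto
    also have "cball 0 (cmod z1) \<inter> (\<lambda>z. cmod (\<phi> z)) -` {1..} = K"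
      by (auto simp: K_def)
    finally have "closed K" .
    then have "compact K"
      by (auto simp: K_def compact_eq_bounded_closed intro!: bounded_subset[OF bounded_cball[of 0 "cmod z1"]])
    moreover have "z1 \<in> K" using ge by (auto simp: K_def \<phi>_def)
    ultimately obtain z0 where z0: "z0 \<in> K" "\<And>z. z \<in> K \<Longrightarrow> cmod z0 \<le> cmod z"
      using continuous_attains_inf[of K cmod] by (auto intro: continuous_intros)
    have z0_le: "cmod z0 \<le> cmod z1" "1 \<le> cmod (\<phi> z0)" using z0(1) by (auto simp: K_def)
    then have z0_disc: "z0 \<in> unit_disc" using z1 by simp
    have less: "cmod (\<phi> z) < 1" if "cmod z < cmod z0" for z
      using z0(2)[of z] that z0_le by (force simp: K_def)
    have \<phi>0: "\<phi> 0 = 0" by (simp add: \<phi>_def s1)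
    then have z0nz: "z0 \<noteq> 0" using z0_le by auto
    have "cmod (\<phi> z0) \<le> 1"
      by (rule norm_le_on_closed_disc[of "cmod z0"])
         (use z0nz less z0_le cont in \<open>auto intro: continuous_on_subset less_imp_le\<close>)
    with z0_le have one: "cmod (\<phi> z0) = 1" by simp
    obtain m :: real where m: "m \<ge> 1" "z0 * deriv \<phi> z0 = of_real m * \<phi> z0"
      using Jack_lemma[OF hol\<phi> \<phi>0 z0_disc z0nz] less one by (metis norm_zero zero_neq_one)
    have "(s has_field_derivative deriv s z0) (at z0)"
      using hols z0_disc by (intro holomorphic_derivI[of _ "ball 0 1"]) auto
    then have "deriv \<phi> z0 = - deriv s z0"
      unfolding \<phi>_def by (intro DERIV_imp_deriv) (auto intro!: derivative_eq_intros)
    then have ds: "z0 * deriv s z0 = - (of_real m * \<phi> z0)"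
      unfolding m(2)[symmetric] by simp
    have s: "s z0 = 1 - \<phi> z0" by (simp add: \<phi>_def)
    have "(s z0)\<^sup>2 - 2 * (z0 * deriv s z0) * s z0 - 1
        = \<phi> z0 * (of_real (2 * m - 2) - of_real (2 * m - 1) * \<phi> z0)"
      unfolding ds s by (simp add: algebra_simps power2_eq_square)
    with U'[OF z0_disc] have "cmod (of_real (2 * m - 2) - of_real (2 * m - 1) * \<phi> z0) < 1"
      by (simp add: norm_mult one)
    moreover have "cmod (of_real (2 * m - 1) * \<phi> z0) - cmod (of_real (2 * m - 2))
        \<le> cmod (of_real (2 * m - 2) - of_real (2 * m - 1) * \<phi> z0)"
      by (metis norm_triangle_ineq2 norm_minus_commute)
    moreover have "cmod (of_real (2 * m - 1) * \<phi> z0) = 2 * m - 1"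
      using m(1) by (simp add: norm_mult one del: of_real_diff)
    moreover have "cmod (of_real (2 * m - 2)) = 2 * m - 2"
      using m(1) by (simp del: of_real_diff)
    ultimately show False by simp
  qed
  with that hols s1 snz fs show ?thesis by blast
qed

section \<open>A Herglotz representation on circles\<close>

text \<open>
  Cauchy's formulas for \<open>F\<close> and \<open>z F'\<close>, rewritten as means over the circle: with \<open>\<zeta>\<close> the
  point on the circle, \<open>d\<zeta> = 2 \<pi> \<i> \<zeta> dt\<close> cancels the factor in front of the contour
  integral and leaves a kernel depending on \<open>z / \<zeta>\<close> alone.
\<close>

lemma Cauchy_average:
  assumes cont: "continuous_on (cball 0 \<rho>) F" and hol: "F holomorphic_on ball 0 \<rho>"
    and z: "cmod z < \<rho>"
  shows "((\<lambda>t. F (circlepath 0 \<rho> t) * (1 / (1 - z / circlepath 0 \<rho> t))) has_integral F z) {0..1}"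
    (is "?A")
    and "((\<lambda>t. F (circlepath 0 \<rho> t) * ((z / circlepath 0 \<rho> t) / (1 - z / circlepath 0 \<rho> t)\<^sup>2))
           has_integral z * deriv F z) {0..1}" (is "?B")
proof -
  have \<rho>: "\<rho> > 0" using z norm_ge_zero[of z] by linarith
  define \<zeta> where "\<zeta> = circlepath 0 \<rho>"
  have \<zeta>: "\<zeta> t \<noteq> 0" "\<zeta> t \<noteq> z" "cmod (\<zeta> t) = \<rho>" for t
    using \<rho> z by (auto simp: \<zeta>_def circlepath norm_mult)
  have vd: "vector_derivative (circlepath 0 \<rho>) (at t within {0..1}) = 2 * pi * \<i> * \<zeta> t"
    if "t \<in> {0..1}" for t
    using that vector_derivative_circlepath01[of t 0 \<rho>] by (simp add: \<zeta>_def) (simp add: circlepath)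
  have "((\<lambda>u. F u / (u - z)) has_contour_integral (2 * of_real pi * \<i> * F z)) (circlepath 0 \<rho>)"
    using Cauchy_integral_circlepath[OF cont hol] z by simp
  then have "((\<lambda>t. F (\<zeta> t) / (\<zeta> t - z) * (2 * pi * \<i> * \<zeta> t)) has_integral (2 * of_real pi * \<i> * F z)) {0..1}"
    unfolding has_contour_integral_def
    by (rule has_integral_eq[rotated]) (auto simp: vd, auto simp: \<zeta>_def)
  from has_integral_divide[OF this, of "2 * of_real pi * \<i>"]
  have "((\<lambda>t. F (\<zeta> t) / (\<zeta> t - z) * (2 * pi * \<i> * \<zeta> t) / (2 * of_real pi * \<i>)) has_integral F z) {0..1}"
    by simp
  then have "((\<lambda>t. F (\<zeta> t) * (1 / (1 - z / \<zeta> t))) has_integral F z) {0..1}"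
    by (rule has_integral_eq[rotated]) (use \<zeta> in \<open>auto simp: field_simps\<close>)
  then show ?A by (simp add: \<zeta>_def)
  define I where "I = contour_integral (circlepath 0 \<rho>) (\<lambda>u. F u / (u - z)\<^sup>2)"
  have "((\<lambda>u. F u / (u - z)\<^sup>2) has_contour_integral I) (circlepath 0 \<rho>)"
    unfolding I_def
    by (intro has_contour_integral_integral Cauchy_derivative_integral_circlepath(1)[OF cont hol]) (use z in auto)
  moreover have "(F has_field_derivative 1 / (2 * of_real pi * \<i>) * I) (at z)"
    unfolding I_def by (rule Cauchy_derivative_integral_circlepath(2)[OF cont hol]) (use z in auto)
  then have "I = 2 * of_real pi * \<i> * deriv F z"
    by (simp add: DERIV_imp_deriv)
  ultimately have "((\<lambda>t. F (\<zeta> t) / (\<zeta> t - z)\<^sup>2 * (2 * pi * \<i> * \<zeta> t)) has_integral (2 * of_real pi * \<i> * deriv F z)) {0..1}"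
    unfolding has_contour_integral_def
    by (simp, elim has_integral_eq[rotated]) (auto simp: vd, auto simp: \<zeta>_def)
  note * = has_integral_mult_right[OF this, of "z / (2 * of_real pi * \<i>)"]
  have cancel: "z / c * (c * w) = z * w" "z / c * (w * (c * w')) = z * (w * w')" if "c \<noteq> 0" for c w w' :: complex
    using that by simp_all
  from cancel(1)[of "2 * of_real pi * \<i>" "deriv F z"]
  have "z / (2 * of_real pi * \<i>) * (2 * of_real pi * \<i> * deriv F z) = z * deriv F z"
    by simp
  note *[unfolded this]
  then have "((\<lambda>t. F (\<zeta> t) * ((z / \<zeta> t) / (1 - z / \<zeta> t)\<^sup>2)) has_integral z * deriv F z) {0..1}"
  proof (rule has_integral_eq[rotated])
    fix t
    have "1 - z / \<zeta> t = (\<zeta> t - z) / \<zeta> t" using \<zeta> by (simp add: field_simps)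
    moreover have "z / (2 * of_real pi * \<i>) * (F (\<zeta> t) / (\<zeta> t - z)\<^sup>2 * (2 * pi * \<i> * \<zeta> t))
        = z * (F (\<zeta> t) / (\<zeta> t - z)\<^sup>2 * \<zeta> t)"
      using cancel(2)[of "2 * of_real pi * \<i>"] by simp
    ultimately show "z / (2 * of_real pi * \<i>) * (F (\<zeta> t) / (\<zeta> t - z)\<^sup>2 * (2 * pi * \<i> * \<zeta> t)) = F (\<zeta> t) * ((z / \<zeta> t) / (1 - z / \<zeta> t)\<^sup>2)"
      using \<zeta>(1)[of t] \<zeta>(2)[of t] by (simp add: power2_eq_square)
  qed
  then show ?B by (simp add: \<zeta>_def)
qed

lemma conjugate_average:
  assumes cont: "continuous_on (cball 0 \<rho>) G" and hol: "G holomorphic_on ball 0 \<rho>" and "\<rho> > 0"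
  shows "((\<lambda>t. cnj (G (circlepath 0 \<rho> t))) has_integral cnj (G 0)) {0..1}"
  using has_integral_linear[OF Cauchy_average(1)[OF cont hol, of 0] bounded_linear_cnj] assms(3)
  by (simp add: o_def)

text \<open>
  On the circle \<open>q = (p - 1) + cnj p\<close>. Against both kernels, \<open>p - 1\<close> is reproduced by Cauchy's
  formula; the second kernel is \<open>1 / (1 - u) + 2 u / (1 - u)\<^sup>2\<close>, which brings in the derivative.
  For the part with \<open>cnj p\<close>, conjugate the integrand: since \<open>cnj \<zeta> = \<rho>\<^sup>2 / \<zeta>\<close> on the circle,
  the conjugated kernel is the boundary value of a holomorphic function with value 1 at the
  origin, so the mean value property yields \<open>p 0 = 1\<close>.
\<close>

lemma Herglotz_representation:
  assumes cont: "continuous_on (cball 0 \<rho>) p" and hol: "p holomorphic_on ball 0 \<rho>" and p0: "p 0 = 1"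
    and z: "cmod z < \<rho>"
  defines "q \<equiv> \<lambda>t. 2 * Re (p (circlepath 0 \<rho> t)) - 1" and "u \<equiv> \<lambda>t. z / circlepath 0 \<rho> t"
  shows "((\<lambda>t. of_real (q t) * (1 / (1 - u t))) has_integral p z) {0..1}"
    and "((\<lambda>t. of_real (q t) * ((1 + u t) / (1 - u t)\<^sup>2)) has_integral p z + 2 * (z * deriv p z)) {0..1}"
proof -
  have \<rho>: "\<rho> > 0" using z norm_ge_zero[of z] by linarith
  define \<zeta> where "\<zeta> = circlepath 0 \<rho>"
  have \<zeta>: "\<zeta> t \<noteq> 0" "\<zeta> t \<noteq> z" "cmod (\<zeta> t) = \<rho>" for t
    using \<rho> z by (auto simp: \<zeta>_def circlepath norm_mult)
  have u1: "u t \<noteq> 1" for t using \<zeta> by (auto simp: u_def \<zeta>_def[symmetric])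
  (* The holomorphic function whose boundary values are the conjugates of u. *)
  define v where "v w = w * cnj z / of_real (\<rho>\<^sup>2)" for w :: complex
  have v: "cnj (u t) = v (\<zeta> t)" for t
  proof -
    have "\<zeta> t * cnj (\<zeta> t) = of_real (\<rho>\<^sup>2)"
      by (metis \<zeta>(3) complex_norm_square of_real_power)
    then show ?thesis using \<zeta>(1)[of t] \<rho>
      by (simp add: u_def v_def \<zeta>_def[symmetric] divide_simps)
  qed
  have v1: "v w \<noteq> 1" if "cmod w \<le> \<rho>" for w
  proof -
    have "cmod w * cmod z < \<rho> * \<rho>"
      using that z \<rho> by (metis mult_less_cancel_left_pos mult_right_mono norm_ge_zero order.strict_trans1)
    then have "cmod (v w) < 1" using \<rho> by (simp add: v_def norm_mult norm_divide power2_eq_square)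
    then show ?thesis by auto
  qed
  have pc: "continuous_on (cball 0 \<rho>) (\<lambda>w. p w - 1)" "(\<lambda>w. p w - 1) holomorphic_on ball 0 \<rho>"
    by (intro continuous_intros cont holomorphic_intros hol)+
  have "(p has_field_derivative deriv p z) (at z)"
    using hol z by (intro holomorphic_derivI[of _ "ball 0 \<rho>"]) auto
  then have dp: "deriv (\<lambda>w. p w - 1) z = deriv p z"
    by (intro DERIV_imp_deriv) (auto intro!: derivative_eq_intros)
  have q: "of_real (q t) = (p (\<zeta> t) - 1) + cnj (p (\<zeta> t))" for t
    by (simp add: q_def \<zeta>_def complex_eq_iff)
  have A: "((\<lambda>t. (p (\<zeta> t) - 1) * (1 / (1 - u t))) has_integral p z - 1) {0..1}"
    using Cauchy_average(1)[OF pc z] by (simp add: u_def \<zeta>_def)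
  have B: "((\<lambda>t. (p (\<zeta> t) - 1) * (u t / (1 - u t)\<^sup>2)) has_integral z * deriv p z) {0..1}"
    using Cauchy_average(2)[OF pc z] by (simp add: u_def \<zeta>_def dp)
  have cv: "continuous_on X v" and hv: "v holomorphic_on X" for X
    unfolding v_def by (auto intro!: continuous_intros holomorphic_intros simp: \<rho>[THEN less_imp_neq, symmetric])
  have "((\<lambda>t. cnj (p (\<zeta> t) * (1 / (1 - v (\<zeta> t))))) has_integral cnj (p 0 * (1 / (1 - v 0)))) {0..1}"
    unfolding \<zeta>_def
    by (rule conjugate_average)
       (use v1 \<rho> in \<open>auto intro!: continuous_intros holomorphic_intros cont hol cv hv\<close>)
  then have A': "((\<lambda>t. cnj (p (\<zeta> t)) * (1 / (1 - u t))) has_integral 1) {0..1}"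
    by (simp add: v[symmetric] p0) (simp add: v_def)
  have "((\<lambda>t. cnj (p (\<zeta> t) * ((1 + v (\<zeta> t)) / (1 - v (\<zeta> t))\<^sup>2))) has_integral
      cnj (p 0 * ((1 + v 0) / (1 - v 0)\<^sup>2))) {0..1}"
    unfolding \<zeta>_def
    by (rule conjugate_average)
       (use v1 \<rho> in \<open>auto intro!: continuous_intros holomorphic_intros cont hol cv hv\<close>)
  then have B': "((\<lambda>t. cnj (p (\<zeta> t)) * ((1 + u t) / (1 - u t)\<^sup>2)) has_integral 1) {0..1}"
    by (simp add: v[symmetric] p0) (simp add: v_def)
  show "((\<lambda>t. of_real (q t) * (1 / (1 - u t))) has_integral p z) {0..1}"
    using has_integral_add[OF A A'] unfolding q by (simp only: distrib_right diff_add_cancel)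
  have K: "(1 + u t) / (1 - u t)\<^sup>2 = 1 / (1 - u t) + 2 * (u t / (1 - u t)\<^sup>2)" for t
    using u1[of t] by (simp add: divide_simps power2_eq_square)
  have "((\<lambda>t. (p (\<zeta> t) - 1) * ((1 + u t) / (1 - u t)\<^sup>2)) has_integral p z - 1 + 2 * (z * deriv p z)) {0..1}"
    using has_integral_add[OF A has_integral_mult_right[OF B, of 2]] unfolding K by (simp add: algebra_simps)
  from has_integral_add[OF this B']
  have "((\<lambda>t. of_real (q t) * ((1 + u t) / (1 - u t)\<^sup>2)) has_integral p z - 1 + 2 * (z * deriv p z) + 1) {0..1}"
    unfolding q by (simp only: distrib_right)
  then show "((\<lambda>t. of_real (q t) * ((1 + u t) / (1 - u t)\<^sup>2)) has_integral p z + 2 * (z * deriv p z)) {0..1}"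
    by simp
qed

section \<open>The pointwise estimate\<close>

text \<open>
  The double \<open>q\<close>-average of \<open>(a s - a t) (b s - b t)\<close> is nonnegative, and it equals twice the
  difference of the two sides. It is evaluated one variable at a time.
\<close>

lemma Chebyshev_integral_inequality:
  fixes q a b :: "real \<Rightarrow> real"
  assumes cont: "continuous_on {l..h} q" "continuous_on {l..h} a" "continuous_on {l..h} b"
    and q: "\<And>t. t \<in> {l..h} \<Longrightarrow> q t \<ge> 0" "integral {l..h} q = 1"
    and mono: "\<And>s t. s \<in> {l..h} \<Longrightarrow> t \<in> {l..h} \<Longrightarrow> (a s - a t) * (b s - b t) \<ge> 0"
  shows "integral {l..h} (\<lambda>t. q t * a t) * integral {l..h} (\<lambda>t. q t * b t)
         \<le> integral {l..h} (\<lambda>t. q t * (a t * b t))"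
proof -
  define A where "A = integral {l..h} (\<lambda>t. q t * a t)"
  define B where "B = integral {l..h} (\<lambda>t. q t * b t)"
  define C where "C = integral {l..h} (\<lambda>t. q t * (a t * b t))"
  have hq: "(q has_integral 1) {l..h}"
    using integrable_integral[OF integrable_continuous_interval[OF cont(1)]] q(2) by simp
  have hA: "((\<lambda>t. q t * a t) has_integral A) {l..h}"
    unfolding A_def by (intro integrable_integral integrable_continuous_interval continuous_intros cont)
  have hB: "((\<lambda>t. q t * b t) has_integral B) {l..h}"
    unfolding B_def by (intro integrable_integral integrable_continuous_interval continuous_intros cont)
  have hC: "((\<lambda>t. q t * (a t * b t)) has_integral C) {l..h}"
    unfolding C_def by (intro integrable_integral integrable_continuous_interval continuous_intros cont)
  have inner: "a s * b s - a s * B - b s * A + C \<ge> 0" if "s \<in> {l..h}" for s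
  proof (rule has_integral_nonneg)
    show "((\<lambda>t. q t * ((a s - a t) * (b s - b t))) has_integral a s * b s - a s * B - b s * A + C) {l..h}"
      using has_integral_add[OF has_integral_diff[OF has_integral_diff[OF
          has_integral_mult_right[OF hq, of "a s * b s"] has_integral_mult_right[OF hB, of "a s"]]
          has_integral_mult_right[OF hA, of "b s"]] hC]
      by (simp add: algebra_simps)
  qed (use q mono that in auto)
  have "C - A * B - B * A + C \<ge> 0"
  proof (rule has_integral_nonneg)
    show "((\<lambda>s. q s * (a s * b s - a s * B - b s * A + C)) has_integral C - A * B - B * A + C) {l..h}"
      using has_integral_add[OF has_integral_diff[OF has_integral_diff[OF
          hC has_integral_mult_left[OF hA, of B]] has_integral_mult_left[OF hB, of A]]
          has_integral_mult_left[OF hq, of C]]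
      by (simp add: algebra_simps)
  qed (use q inner in auto)
  then show ?thesis by (simp add: A_def B_def C_def)
qed

text \<open>
  On a circle about the origin \<open>|1 - u|\<close> decreases and \<open>|1 + u|\<close> increases with \<open>Re u\<close>, so
  the moduli of both factors of the derivative of the Koebe function increase with \<open>Re u\<close>.
\<close>

lemma koebe_factors_similarly_ordered:
  fixes u v :: complex
  assumes "cmod u = cmod v" "cmod v < 1"
  shows "0 \<le> (1 / cmod (1 - u) - 1 / cmod (1 - v)) *
     (cmod (1 + u) / (cmod (1 - u))\<^sup>2 - cmod (1 + v) / (cmod (1 - v))\<^sup>2)"
proof -
  have *: "1 / cmod (1 - v) \<le> 1 / cmod (1 - u) \<and>
      cmod (1 + v) / (cmod (1 - v))\<^sup>2 \<le> cmod (1 + u) / (cmod (1 - u))\<^sup>2"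
    if "cmod u = cmod v" "cmod v < 1" "Re v \<le> Re u" for u v :: complex
  proof -
    have sq: "(cmod (1 - w))\<^sup>2 = 1 + (cmod w)\<^sup>2 - 2 * Re w" "(cmod (1 + w))\<^sup>2 = 1 + (cmod w)\<^sup>2 + 2 * Re w" for w
      by (simp_all add: cmod_power2 algebra_simps) (simp_all add: power2_eq_square algebra_simps)
    have m: "cmod (1 - u) \<le> cmod (1 - v)"
      by (rule power2_le_imp_le) (use that in \<open>auto simp: sq\<close>)
    have p: "cmod (1 + v) \<le> cmod (1 + u)"
      by (rule power2_le_imp_le) (use that in \<open>auto simp: sq\<close>)
    have pos: "cmod (1 - u) > 0" using that by auto
    show ?thesis
      using m pos p by (intro conjI frac_le power_mono) auto
  qed
  show ?thesis
  proof (cases "Re v \<le> Re u")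
    case True
    with *[of u v] assms show ?thesis by (intro mult_nonneg_nonneg) auto
  next
    case False
    with *[of v u] assms show ?thesis by (intro mult_nonpos_nonpos) auto
  qed
qed

lemma deriv_koebe:
  assumes "u \<noteq> 1"
  shows "deriv koebe u = (1 / (1 - u)) * ((1 + u) / (1 - u)\<^sup>2)"
proof (rule DERIV_imp_deriv)
  define w where "w = 1 - u"
  have u: "u = 1 - w" and w: "w \<noteq> 0" using assms by (auto simp: w_def)
  have "(koebe has_field_derivative (w\<^sup>2 - u * (2 * w * (- 1))) / (w\<^sup>2 * w\<^sup>2)) (at u)"
    unfolding koebe_def w_def using assms by (auto intro!: derivative_eq_intros)
  also have "(w\<^sup>2 - u * (2 * w * (- 1))) / (w\<^sup>2 * w\<^sup>2) = (1 / (1 - u)) * ((1 + u) / (1 - u)\<^sup>2)"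
    unfolding u using w by (simp add: divide_simps power2_eq_square) (simp add: algebra_simps)
  finally show "(koebe has_field_derivative (1 / (1 - u)) * ((1 + u) / (1 - u)\<^sup>2)) (at u)" .
qed

text \<open>
  The pointwise form of the result. The density \<open>q\<close> is the same for all \<open>z\<close>, which is what
  makes it possible to integrate the estimate over a circle.
\<close>

lemma deriv_le_koebe_average:
  assumes hol: "p holomorphic_on unit_disc" and p0: "p 0 = 1"
    and half: "\<And>z. z \<in> unit_disc \<Longrightarrow> Re (p z) > 1 / 2"
    and f: "\<And>z. z \<in> unit_disc \<Longrightarrow> f z = z * (p z)\<^sup>2"
    and \<rho>: "\<rho> < 1" and z: "cmod z < \<rho>"
  defines "q \<equiv> \<lambda>t. 2 * Re (p (circlepath 0 \<rho> t)) - 1"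
  shows "continuous_on {0..1} q" "\<And>t. t \<in> {0..1} \<Longrightarrow> 0 \<le> q t" "integral {0..1} q = 1"
    "cmod (deriv f z) \<le> integral {0..1} (\<lambda>t. q t * cmod (deriv koebe (z / circlepath 0 \<rho> t)))"
proof -
  have \<rho>0: "\<rho> > 0" using z norm_ge_zero[of z] by linarith
  have zd: "z \<in> unit_disc" using z \<rho> by simp
  define u where "u t = z / circlepath 0 \<rho> t" for t
  have nz: "circlepath 0 \<rho> t \<noteq> 0" and n\<rho>: "cmod (circlepath 0 \<rho> t) = \<rho>" for t
    using \<rho>0 by (auto simp: circlepath norm_mult)
  have cc: "continuous_on X (circlepath 0 \<rho>)" for X
    unfolding circlepath by (intro continuous_intros)
  have cu: "continuous_on X u" for X
    unfolding u_def using nz by (intro continuous_intros cc) auto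
  have nu: "cmod (u t) = cmod z / \<rho>" for t using n\<rho> by (simp add: u_def norm_divide)
  have nu1: "cmod (u t) < 1" for t using z \<rho>0 by (simp add: nu)
  then have u1: "u t \<noteq> 1" for t by (metis norm_one less_irrefl)
  have cp: "continuous_on (cball 0 \<rho>) p" and hp: "p holomorphic_on ball 0 \<rho>"
    using hol \<rho> by (auto intro!: holomorphic_on_imp_continuous_on elim!: holomorphic_on_subset)
  show cq: "continuous_on {0..1} q"
    unfolding q_def
    by (intro continuous_intros continuous_on_compose2[OF cp cc]) (auto simp: n\<rho>)
  show q0: "0 \<le> q t" for t
    using half[of "circlepath 0 \<rho> t"] \<rho> by (simp add: q_def n\<rho>)
  have "((\<lambda>t. of_real (q t)) has_integral (1::complex)) {0..1}"
    using Herglotz_representation(1)[OF cp hp p0, of 0] \<rho>0 by (simp add: q_def p0)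
  from has_integral_linear[OF this bounded_linear_Re]
  have "(q has_integral 1) {0..1}" by (simp add: o_def)
  then show q1: "integral {0..1} q = 1" by (rule integral_unique)
  have "(p has_field_derivative deriv p z) (at z)"
    using hol zd by (intro holomorphic_derivI[of _ "ball 0 1"]) auto
  then have "((\<lambda>z. z * (p z)\<^sup>2) has_field_derivative p z * (p z + 2 * (z * deriv p z))) (at z)"
    by (auto intro!: derivative_eq_intros simp: power2_eq_square algebra_simps)
  then have "(f has_field_derivative p z * (p z + 2 * (z * deriv p z))) (at z)"
    by (rule has_field_derivative_transform_within_open[of _ _ _ unit_disc]) (use zd f in auto)
  then have "cmod (deriv f z) = cmod (p z) * cmod (p z + 2 * (z * deriv p z))"
    by (simp add: DERIV_imp_deriv norm_mult)
  also have "\<dots> \<le> integral {0..1} (\<lambda>t. q t * (1 / cmod (1 - u t))) *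
                  integral {0..1} (\<lambda>t. q t * (cmod (1 + u t) / (cmod (1 - u t))\<^sup>2))"
  proof (intro mult_mono)
    have "((\<lambda>t. of_real (q t) * (1 / (1 - u t))) has_integral p z) {0..1}"
      unfolding q_def u_def by (rule Herglotz_representation(1)[OF cp hp p0 z])
    then show "cmod (p z) \<le> integral {0..1} (\<lambda>t. q t * (1 / cmod (1 - u t)))"
      by (subst integral_unique[symmetric], assumption, intro integral_norm_bound_integral)
         (use u1 q0 in \<open>auto intro!: integrable_continuous_interval continuous_intros cq cu
           simp: norm_mult norm_divide has_integral_integrable\<close>)
    have "((\<lambda>t. of_real (q t) * ((1 + u t) / (1 - u t)\<^sup>2)) has_integral p z + 2 * (z * deriv p z)) {0..1}"
      unfolding q_def u_def by (rule Herglotz_representation(2)[OF cp hp p0 z])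
    then show "cmod (p z + 2 * (z * deriv p z)) \<le>
       integral {0..1} (\<lambda>t. q t * (cmod (1 + u t) / (cmod (1 - u t))\<^sup>2))"
      by (subst integral_unique[symmetric], assumption, intro integral_norm_bound_integral)
         (use u1 q0 in \<open>auto intro!: integrable_continuous_interval continuous_intros cq cu
           simp: norm_mult norm_divide norm_power has_integral_integrable\<close>)
    show "0 \<le> integral {0..1} (\<lambda>t. q t * (1 / cmod (1 - u t)))"
      using q0 by (intro integral_nonneg integrable_continuous_interval continuous_intros cq cu) (use u1 in auto)
  qed auto
  also have "\<dots> \<le> integral {0..1} (\<lambda>t. q t * (1 / cmod (1 - u t) * (cmod (1 + u t) / (cmod (1 - u t))\<^sup>2)))"
    by (intro Chebyshev_integral_inequality koebe_factors_similarly_ordered continuous_intros cq cu)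
       (use u1 q0 q1 nu1 in \<open>auto simp: nu\<close>)
  also have "(\<lambda>t. q t * (1 / cmod (1 - u t) * (cmod (1 + u t) / (cmod (1 - u t))\<^sup>2)))
      = (\<lambda>t. q t * cmod (deriv koebe (u t)))"
    using u1 by (simp add: deriv_koebe norm_mult norm_divide norm_power)
  finally show "cmod (deriv f z) \<le> integral {0..1} (\<lambda>t. q t * cmod (deriv koebe (z / circlepath 0 \<rho> t)))"
    by (simp add: u_def)
qed

section \<open>Integration over the circle\<close>

lemma integral_periodic_shift:
  fixes h :: "real \<Rightarrow> real"
  assumes cont: "continuous_on UNIV h" and per: "\<And>x. h (x + P) = h x" and c: "0 \<le> c" "c \<le> P"
  shows "integral {0..P} (\<lambda>x. h (x - c)) = integral {0..P} h"
proof -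
  have int: "h integrable_on {a..b}" for a b
    by (intro integrable_continuous_interval continuous_on_subset[OF cont]) auto
  have "integral {0..P} (\<lambda>x. h (x - c)) = integral {0..P} (h \<circ> ((+) (- c)))"
    by (simp add: o_def)
  also have "\<dots> = integral {- c..P - c} h"
    by (subst integral_shift_Icc_real) simp
  also have "\<dots> = integral {- c..0} h + integral {0..P - c} h"
    using c int by (intro Henstock_Kurzweil_Integration.integral_combine[symmetric]) auto
  also have "integral {- c..0} h = integral {- c..0} (h \<circ> ((+) P))"
    by (simp add: o_def per add.commute[of P])
  also have "\<dots> = integral {P - c..P} h"
    by (subst integral_shift_Icc_real) simp
  also have "\<dots> + integral {0..P - c} h = integral {0..P} h"
    using c int Henstock_Kurzweil_Integration.integral_combine[of 0 "P - c" P h] by simp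
  finally show ?thesis .
qed

lemma continuous_on_deriv_koebe: "continuous_on unit_disc (deriv koebe)"
proof -
  have "koebe holomorphic_on unit_disc"
    unfolding koebe_def by (intro holomorphic_intros) auto
  then show ?thesis
    by (intro holomorphic_on_imp_continuous_on holomorphic_deriv) auto
qed

lemma koebe_mean_rotate:
  assumes R: "0 \<le> R" "R < 1" and t: "t \<in> {0..1}"
  shows "integral {0..2 * pi} (\<lambda>\<theta>. cmod (deriv koebe (of_real R * exp (\<i> * of_real (\<theta> - 2 * pi * t)))))
       = integral {0..2 * pi} (\<lambda>\<theta>. cmod (deriv koebe (of_real R * exp (\<i> * of_real \<theta>))))"
proof (rule integral_periodic_shift)
  show "continuous_on UNIV (\<lambda>\<theta>. cmod (deriv koebe (of_real R * exp (\<i> * of_real \<theta>))))"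
    using R by (intro continuous_intros continuous_on_compose2[OF continuous_on_deriv_koebe])
               (auto simp: norm_mult)
  show "cmod (deriv koebe (of_real R * exp (\<i> * of_real (\<theta> + 2 * pi)))) =
        cmod (deriv koebe (of_real R * exp (\<i> * of_real \<theta>)))" for \<theta>
    using exp_two_pi_i by (simp add: exp_add ring_distribs mult.commute[of \<i>])
qed (use t in auto)

text \<open>
  Integrating the pointwise estimate over \<open>|z| = r\<close> and interchanging the integrals. The radius
  \<open>r\<close> is enlarged to \<open>r / \<rho>\<close> because the density lives on the circle \<open>|\<zeta>| = \<rho>\<close>, inside
  the open disc on which \<open>p\<close> is defined.
\<close>

lemma integral_deriv_le_koebe_dilated:
  assumes hol: "p holomorphic_on unit_disc" and p0: "p 0 = 1"
    and half: "\<And>z. z \<in> unit_disc \<Longrightarrow> Re (p z) > 1 / 2"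
    and f: "\<And>z. z \<in> unit_disc \<Longrightarrow> f z = z * (p z)\<^sup>2"
    and r: "0 \<le> r" "r < \<rho>" and \<rho>: "\<rho> < 1"
  shows "integral {0..2 * pi} (\<lambda>\<theta>. cmod (deriv f (of_real r * exp (\<i> * of_real \<theta>))))
       \<le> integral {0..2 * pi} (\<lambda>\<theta>. cmod (deriv koebe (of_real (r / \<rho>) * exp (\<i> * of_real \<theta>))))"
    (is "?L \<le> ?J")
proof -
  define q where "q t = 2 * Re (p (circlepath 0 \<rho> t)) - 1" for t
  define K where "K \<theta> t = q t * cmod (deriv koebe (of_real (r / \<rho>) * exp (\<i> * of_real (\<theta> - 2 * pi * t))))" for \<theta> t :: real
  have \<rho>0: "\<rho> > 0" and R: "0 \<le> r / \<rho>" "r / \<rho> < 1" using r by auto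
  have norm_r: "cmod (of_real r * exp (\<i> * of_real \<theta>)) = r" for \<theta> :: real
    using r by (simp add: norm_mult)
  note avg = deriv_le_koebe_average[OF hol p0 half f \<rho>, folded q_def]
  have q: "continuous_on {0..1} q" "integral {0..1} q = 1"
    using avg(1,3)[of 0] \<rho>0 by auto
  have le: "cmod (deriv f (of_real r * exp (\<i> * of_real \<theta>))) \<le> integral {0..1} (K \<theta>)" for \<theta>
  proof -
    have "of_real r * exp (\<i> * of_real \<theta>) / circlepath 0 \<rho> t
        = of_real (r / \<rho>) * exp (\<i> * of_real (\<theta> - 2 * pi * t))" for t
      by (simp add: circlepath right_diff_distrib exp_diff mult_ac)
    with avg(4)[of "of_real r * exp (\<i> * of_real \<theta>)"] r show ?thesis
      by (simp add: norm_r K_def[abs_def])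
  qed
  have hk: "continuous_on (cbox (0, 0) (2 * pi, 1)) (\<lambda>(\<theta>, t). K \<theta> t)"
    unfolding K_def split_def using R
    by (intro continuous_intros continuous_on_compose2[OF continuous_on_deriv_koebe]
         continuous_on_compose2[OF q(1)]) (auto simp: norm_mult simp del: of_real_diff of_real_divide)
  have "(\<lambda>z. z * (p z)\<^sup>2) holomorphic_on unit_disc"
    by (intro holomorphic_intros hol)
  then have "f holomorphic_on unit_disc"
    by (rule holomorphic_transform) (use f in auto)
  then have cdf: "continuous_on unit_disc (deriv f)"
    by (intro holomorphic_on_imp_continuous_on holomorphic_deriv) auto
  have cf: "continuous_on {0..2 * pi} (\<lambda>\<theta>. cmod (deriv f (of_real r * exp (\<i> * of_real \<theta>))))"
    by (intro continuous_intros continuous_on_compose2[OF cdf])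
       (use r \<rho> in \<open>auto simp: norm_mult\<close>)
  have cK: "continuous_on {0..2 * pi} (\<lambda>\<theta>. integral {0..1} (K \<theta>))"
    using integral_continuous_on_param[of "{0..2 * pi}" 0 1 K] hk by (simp add: cbox_Pair_eq)
  have "?L \<le> integral {0..2 * pi} (\<lambda>\<theta>. integral {0..1} (K \<theta>))"
    by (intro integral_le integrable_continuous_interval cf cK le)
  also have "\<dots> = integral {0..1} (\<lambda>t. integral {0..2 * pi} (\<lambda>\<theta>. K \<theta> t))"
    using integral_swap_continuous[OF hk] by simp
  also have "\<dots> = integral {0..1} (\<lambda>t. q t * ?J)"
    unfolding K_def by (intro integral_cong) (simp only: integral_mult_right koebe_mean_rotate[OF R])
  also have "\<dots> = ?J" using q(2) by simp
  finally show ?thesis .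
qed

theorem corollary2p2:
  fixes f :: "complex \<Rightarrow> complex" and r :: real
  assumes "f \<in> class_U" and "0 < r" and "r < 1"
  shows "arclength r f \<le> arclength r koebe"
proof -
  obtain s where s: "s holomorphic_on unit_disc" "s 0 = 1" "\<And>z. z \<in> unit_disc \<Longrightarrow> s z \<noteq> 0"
    "\<And>z. z \<in> unit_disc \<Longrightarrow> f z = z / (s z)\<^sup>2"
    "\<And>z. z \<in> unit_disc \<Longrightarrow> cmod (1 - s z) < 1"
    using class_U_imp_sqrt[OF assms(1)] by blast
  define p where "p z = 1 / s z" for z
  have p: "p holomorphic_on unit_disc" "p 0 = 1"
    unfolding p_def using s by (auto intro!: holomorphic_intros)
  have fp: "f z = z * (p z)\<^sup>2" if "z \<in> unit_disc" for z
    using s(4)[OF that] by (simp add: p_def power_divide)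
  have half: "Re (p z) > 1 / 2" if "z \<in> unit_disc" for z
  proof -
    (* Inversion maps the disc about 1 of radius 1 to the half-plane Re > 1/2. *)
    have "(cmod (1 - s z))\<^sup>2 < 1"
      using s(5)[OF that] by (simp add: power_less_one_iff)
    then have "(cmod (s z))\<^sup>2 < 2 * Re (s z)"
      by (simp add: cmod_power2 power2_diff)
    then have "1 / 2 < Re (s z) / (cmod (s z))\<^sup>2"
      using s(3)[OF that] by (simp add: field_simps)
    moreover have "Re (p z) = Re (s z) / (cmod (s z))\<^sup>2"
      by (simp add: p_def Re_divide cmod_power2)
    ultimately show ?thesis by simp
  qed
  define J where "J R = integral {0..2 * pi} (\<lambda>\<theta>. cmod (deriv koebe (of_real R * exp (\<i> * of_real \<theta>))))" for R
  (* It remains to let \<rho> tend to 1, using continuity of the Koebe integral in the radius. *)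
  have "continuous_on ({-1<..<1} \<times> cbox 0 (2 * pi))
      (\<lambda>(R, \<theta>). cmod (deriv koebe (of_real R * exp (\<i> * of_real \<theta>))))"
    unfolding split_def
    by (intro continuous_intros continuous_on_compose2[OF continuous_on_deriv_koebe])
       (auto simp: norm_mult)
  from integral_continuous_on_param[OF this] have "continuous_on {-1<..<1} J"
    by (simp add: J_def[abs_def])
  then have "isCont J r"
    using assms by (simp add: continuous_on_eq_continuous_at)
  moreover have "((\<lambda>\<rho>. r / \<rho>) \<longlongrightarrow> r) (at_left 1)"
    by (auto intro!: tendsto_eq_intros)
  ultimately have lim: "((\<lambda>\<rho>. J (r / \<rho>)) \<longlongrightarrow> J r) (at_left 1)"
    by (rule isCont_tendsto_compose)
  have "eventually (\<lambda>\<rho>. \<rho> \<in> {r<..<1}) (at_left 1)"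
    using assms by (intro eventually_at_leftI[of r]) auto
  then have "eventually (\<lambda>\<rho>. integral {0..2 * pi} (\<lambda>\<theta>. cmod (deriv f (of_real r * exp (\<i> * of_real \<theta>)))) \<le> J (r / \<rho>)) (at_left 1)"
    by eventually_elim
       (use integral_deriv_le_koebe_dilated[OF p half fp] assms in \<open>auto simp: J_def\<close>)
  then have "integral {0..2 * pi} (\<lambda>\<theta>. cmod (deriv f (of_real r * exp (\<i> * of_real \<theta>)))) \<le> J r"
    by (intro tendsto_lowerbound[OF lim]) auto
  then show ?thesis
    using assms by (simp add: arclength_def J_def)
qed

end
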